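(* (i) The theory $\mathsf{WF}^{-}$ is not finitely axiomatizable. (ii) The theory $\mathsf{F}^{-}$ is not interpretable in the arithmetical theory $\mathsf{R}$.
   Context: **Interpretability.** Theories are first-order theories with equality, identified with their sets of non-logical axioms. A (relative) interpretation of a theory $V$ in a theory $U$ is given by a translation $\tau$ of the language of $V$ into that of $U$: a formula $\delta(x)$ (the domain) with $U\vdash\exists x\,\delta(x)$; for each $n$-ary relation symbol of $V$ a formula in $n$ free variables; for each $n$-ary function symbol a formula in $n+1$ free variables which $U$ proves to be total and functional on $\delta$. Translations commute with connectives, and quantifiers are relativized to $\delta$. $V$ is interpretable in $U$ if for some such $\tau$, $U\vdash\varphi^{\tau}$ for every axiom $\varphi$ of $V$. **The theory $\mathsf{F}^{-}$** (language $L=\{\emptyset,\langle\cdot\rangle,\uplus,\sqsubseteq\}$: constant, unary function, binary function, binary relation; axioms universally quantified): $\mathrm{F}_1$: $(x\uplus y)\uplus z=x\uplus(y\uplus z)$; $\mathrm{F}_2$: $x\uplus y=y\uplus x$; $\mathrm{F}_3$: $x\uplus\emptyset=x$; $\mathrm{F}_4$: $x\uplus z=y\uplus z\rightarrow x=y$; $\mathrm{F}_5$: $\langle x\rangle\ne\emptyset$; $\mathrm{F}_6$: $x\uplus y=\emptyset\rightarrow x=\emptyset$; $\mathrm{F}_7$: $\langle x\rangle=\langle y\rangle\rightarrow x=y$; $\mathrm{F}_8$: $u\uplus v=\langle x\rangle\uplus w\rightarrow\exists w'\,(u=\langle x\rangle\uplus w'\vee v=\langle x\rangle\uplus w')$;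 $\mathrm{F}_9$: $x\sqsubseteq t\leftrightarrow\bigl(x=t\vee\exists w\,\exists u\,(t=w\uplus\langle u\rangle\wedge x\sqsubseteq u)\bigr)$. **Hereditarily finite multisets.** A multiset over a set $X$ is a function $X\to\mathbb{N}$ with finite support. $\mathrm{HFM}=\bigcup_n\mathcal{M}_n$, where $\mathcal{M}_0=\emptyset$ and $\mathcal{M}_{n+1}$ is the set of finite multisets over $\mathcal{M}_n$; the rank of $m$ is the least $n$ with $m\in\mathcal{M}_{n+1}$. $\emptyset$ is the empty multiset, $\langle x\rangle$ the singleton multiset containing $x$ once, $x\uplus y$ the multiset union (multiplicities add). Put $u\in_1 v$ iff $\exists w\,(v=w\uplus\langle u\rangle)$, and by recursion on rank: $x\sqsubseteq t$ iff $x=t$ or $\exists u\,(u\in_1 t\wedge x\sqsubseteq u)$. $\mathbb{M}=(\mathrm{HFM};\emptyset,\langle\cdot\rangle,\uplus,\sqsubseteq)$. **Normal forms.** Let $\preceq$ be the length-lexicographic order on closed $L$-terms viewed as strings over $\langle,\rangle,\uplus,\emptyset$ (for a fixed order of these symbols). Normal closed terms: $\emptyset$ is normal; if $t_1\preceq\dots\preceq t_k$ ($k\ge1$) are normal then $\langle t_1\rangle\uplus(\langle t_2\rangle\uplus(\dots\uplus\langle t_k\rangle))$ is normal. $\mathrm{nf}(s)$ of a closed term $s$ is computed by recursively normalizing arguments, flattening $\uplus$, deleting $\emptyset$-factors, and sorting. For a closed term $t$, $\mathrm{hull}(t)$ is the finite set of normal terms $s$ with $\mathbb{M}\models s\sqsubseteq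 t$. **The theory $\mathsf{WF}^{-}$** (language $L$) has the axioms $\mathrm{F}_1,\mathrm{F}_2,\mathrm{F}_3$ and the schemes $\mathrm{W}_1$: $\neg(s=t)$ for closed terms $s,t$ with $\mathrm{nf}(s)\not\equiv\mathrm{nf}(t)$ (syntactically different); $\mathrm{W}_2$: $\forall x\,(x\sqsubseteq t\leftrightarrow\bigvee_{s\in\mathrm{hull}(t)}x=s)$ for each closed term $t$. **The theory $\mathsf{R}$** (language $\{0,S,+,\cdot,\le\}$, numerals $\bar n=S^n0$) has, for all $n,m\in\mathbb{N}$: $\bar n+\bar m=\overline{n+m}$; $\bar n\cdot\bar m=\overline{n\cdot m}$; $\bar n\ne\bar m$ for $n\ne m$; $\forall x\,(x\le\bar n\leftrightarrow x=\bar0\vee\dots\vee x=\bar n)$; $\forall x\,(x\le\bar n\vee\bar n\le x)$. *)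

theory Defs
  imports "HOL-Library.Multiset" "HOL-Library.List_Lenlexorder"
begin

section \<open>First-order logic with equality\<close>

text \<open>
  Variables are de Bruijn indices. A language is given by a type \<open>'f\<close> of function symbols and a
  type \<open>'r\<close> of relation symbols together with their arities; constants are nullary function symbols.
\<close>

record ('f, 'r) lang =
  fun_arity :: "'f \<Rightarrow> nat"
  rel_arity :: "'r \<Rightarrow> nat"

datatype 'f tm = Var nat | Fn 'f "'f tm list"

datatype ('f, 'r) fm =
    Fls
  | Eq "'f tm" "'f tm" (infix "\<^bold>=" 60)
  | Rel 'r "'f tm list"
  | Imp "('f, 'r) fm" "('f, 'r) fm" (infixr "\<^bold>\<longrightarrow>" 54)
  | Forall "('f, 'r) fm"

abbreviation Neg :: "('f, 'r) fm \<Rightarrow> ('f, 'r) fm" where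
  "Neg p \<equiv> p \<^bold>\<longrightarrow> Fls"

abbreviation Disj :: "('f, 'r) fm \<Rightarrow> ('f, 'r) fm \<Rightarrow> ('f, 'r) fm" (infixr "\<^bold>\<or>" 56) where
  "p \<^bold>\<or> q \<equiv> Neg p \<^bold>\<longrightarrow> q"

abbreviation Conj :: "('f, 'r) fm \<Rightarrow> ('f, 'r) fm \<Rightarrow> ('f, 'r) fm" (infixr "\<^bold>\<and>" 58) where
  "p \<^bold>\<and> q \<equiv> Neg (p \<^bold>\<longrightarrow> Neg q)"

abbreviation Iff :: "('f, 'r) fm \<Rightarrow> ('f, 'r) fm \<Rightarrow> ('f, 'r) fm" (infix "\<^bold>\<longleftrightarrow>" 52) where
  "p \<^bold>\<longleftrightarrow> q \<equiv> (p \<^bold>\<longrightarrow> q) \<^bold>\<and> (q \<^bold>\<longrightarrow> p)"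

abbreviation Exists :: "('f, 'r) fm \<Rightarrow> ('f, 'r) fm" where
  "Exists p \<equiv> Neg (Forall (Neg p))"

text \<open>The quantifier of \<open>foralls n p\<close> nearest to \<open>p\<close> binds index 0, the outermost one index \<open>n - 1\<close>.\<close>

definition foralls :: "nat \<Rightarrow> ('f, 'r) fm \<Rightarrow> ('f, 'r) fm" where
  "foralls n = Forall ^^ n"

fun disj_list :: "('f, 'r) fm list \<Rightarrow> ('f, 'r) fm" where
  "disj_list [] = Fls"
| "disj_list [p] = p"
| "disj_list (p # ps) = p \<^bold>\<or> disj_list ps"

fun is_tm :: "('f, 'r) lang \<Rightarrow> 'f tm \<Rightarrow> bool" where
  "is_tm L (Var x) \<longleftrightarrow> True"
| "is_tm L (Fn f ts) \<longleftrightarrow> length ts = fun_arity L f \<and> (\<forall>t\<in>set ts. is_tm L t)"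

primrec is_fm :: "('f, 'r) lang \<Rightarrow> ('f, 'r) fm \<Rightarrow> bool" where
  "is_fm L Fls \<longleftrightarrow> True"
| "is_fm L (s \<^bold>= t) \<longleftrightarrow> is_tm L s \<and> is_tm L t"
| "is_fm L (Rel r ts) \<longleftrightarrow> length ts = rel_arity L r \<and> (\<forall>t\<in>set ts. is_tm L t)"
| "is_fm L (p \<^bold>\<longrightarrow> q) \<longleftrightarrow> is_fm L p \<and> is_fm L q"
| "is_fm L (Forall p) \<longleftrightarrow> is_fm L p"

fun fv_tm :: "'f tm \<Rightarrow> nat set" where
  "fv_tm (Var x) = {x}"
| "fv_tm (Fn f ts) = (\<Union>t\<in>set ts. fv_tm t)"

primrec fv :: "('f, 'r) fm \<Rightarrow> nat set" where
  "fv Fls = {}"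
| "fv (s \<^bold>= t) = fv_tm s \<union> fv_tm t"
| "fv (Rel r ts) = (\<Union>t\<in>set ts. fv_tm t)"
| "fv (p \<^bold>\<longrightarrow> q) = fv p \<union> fv q"
| "fv (Forall p) = {x. Suc x \<in> fv p}"

definition sentences :: "('f, 'r) lang \<Rightarrow> ('f, 'r) fm set" where
  "sentences L = {p. is_fm L p \<and> fv p = {}}"

subsection \<open>Substitution and provability\<close>

fun subst_tm :: "(nat \<Rightarrow> 'f tm) \<Rightarrow> 'f tm \<Rightarrow> 'f tm" where
  "subst_tm \<sigma> (Var x) = \<sigma> x"
| "subst_tm \<sigma> (Fn f ts) = Fn f (map (subst_tm \<sigma>) ts)"

definition under_binder :: "(nat \<Rightarrow> 'f tm) \<Rightarrow> nat \<Rightarrow> 'f tm" where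
  "under_binder \<sigma> = case_nat (Var 0) (\<lambda>x. subst_tm (Var \<circ> Suc) (\<sigma> x))"

primrec subst :: "(nat \<Rightarrow> 'f tm) \<Rightarrow> ('f, 'r) fm \<Rightarrow> ('f, 'r) fm" where
  "subst \<sigma> Fls = Fls"
| "subst \<sigma> (s \<^bold>= t) = subst_tm \<sigma> s \<^bold>= subst_tm \<sigma> t"
| "subst \<sigma> (Rel r ts) = Rel r (map (subst_tm \<sigma>) ts)"
| "subst \<sigma> (p \<^bold>\<longrightarrow> q) = subst \<sigma> p \<^bold>\<longrightarrow> subst \<sigma> q"
| "subst \<sigma> (Forall p) = Forall (subst (under_binder \<sigma>) p)"

definition lift :: "('f, 'r) fm \<Rightarrow> ('f, 'r) fm" where
  "lift = subst (Var \<circ> Suc)"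

definition inst :: "'f tm \<Rightarrow> ('f, 'r) fm \<Rightarrow> ('f, 'r) fm" where
  "inst t = subst (case_nat t Var)"

text \<open>
  Classical natural deduction; all formulas in a derivation belong to the language \<open>L\<close>.
  In \<open>ForallI\<close> the hypotheses are lifted, so that index 0 is a fresh variable.
\<close>

inductive derives :: "('f, 'r) fm set \<Rightarrow> ('f, 'r) lang \<Rightarrow> ('f, 'r) fm \<Rightarrow> bool"
  ("(_ \<turnstile>\<^bsub>_\<^esub> _)" [50, 0, 50] 40) where
  Ax: "p \<in> \<Gamma> \<Longrightarrow> is_fm L p \<Longrightarrow> \<Gamma> \<turnstile>\<^bsub>L\<^esub> p"
| ImpI: "insert p \<Gamma> \<turnstile>\<^bsub>L\<^esub> q \<Longrightarrow> is_fm L p \<Longrightarrow> \<Gamma> \<turnstile>\<^bsub>L\<^esub> p \<^bold>\<longrightarrow> q"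
| ImpE: "\<Gamma> \<turnstile>\<^bsub>L\<^esub> p \<^bold>\<longrightarrow> q \<Longrightarrow> \<Gamma> \<turnstile>\<^bsub>L\<^esub> p \<Longrightarrow> \<Gamma> \<turnstile>\<^bsub>L\<^esub> q"
| Contr: "insert (Neg p) \<Gamma> \<turnstile>\<^bsub>L\<^esub> Fls \<Longrightarrow> is_fm L p \<Longrightarrow> \<Gamma> \<turnstile>\<^bsub>L\<^esub> p"
| ForallI: "lift ` \<Gamma> \<turnstile>\<^bsub>L\<^esub> p \<Longrightarrow> \<Gamma> \<turnstile>\<^bsub>L\<^esub> Forall p"
| ForallE: "\<Gamma> \<turnstile>\<^bsub>L\<^esub> Forall p \<Longrightarrow> is_tm L t \<Longrightarrow> \<Gamma> \<turnstile>\<^bsub>L\<^esub> inst t p"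
| EqI: "is_tm L t \<Longrightarrow> \<Gamma> \<turnstile>\<^bsub>L\<^esub> t \<^bold>= t"
| EqE: "\<Gamma> \<turnstile>\<^bsub>L\<^esub> s \<^bold>= t \<Longrightarrow> \<Gamma> \<turnstile>\<^bsub>L\<^esub> inst s p \<Longrightarrow> \<Gamma> \<turnstile>\<^bsub>L\<^esub> inst t p"

definition finitely_axiomatizable :: "('f, 'r) lang \<Rightarrow> ('f, 'r) fm set \<Rightarrow> bool" where
  "finitely_axiomatizable L T \<longleftrightarrow>
     (\<exists>A. finite A \<and> A \<subseteq> sentences L \<and> (\<forall>p\<in>sentences L. (A \<turnstile>\<^bsub>L\<^esub> p) \<longleftrightarrow> (T \<turnstile>\<^bsub>L\<^esub> p)))"

section \<open>Relative interpretations\<close>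

text \<open>
  A translation assigns to the domain a formula in the variable 0, to an \<open>n\<close>-ary relation symbol a
  formula in the variables \<open>0, \<dots>, n - 1\<close>, and to an \<open>n\<close>-ary function symbol a formula in the
  variables \<open>0, \<dots>, n\<close>, where \<open>n\<close> stands for the value. Equality is translated as equality.
\<close>

record ('f, 'r, 'g, 's) translation =
  domain :: "('g, 's) fm"
  fun_graph :: "'f \<Rightarrow> ('g, 's) fm"
  rel_def :: "'r \<Rightarrow> ('g, 's) fm"

definition is_translation ::
  "('f, 'r) lang \<Rightarrow> ('g, 's) lang \<Rightarrow> ('f, 'r, 'g, 's) translation \<Rightarrow> bool" where
  "is_translation L K \<tau> \<longleftrightarrow>
     is_fm K (domain \<tau>) \<and> fv (domain \<tau>) \<subseteq> {0} \<and>
     (\<forall>f. is_fm K (fun_graph \<tau> f) \<and> fv (fun_graph \<tau> f) \<subseteq> {..fun_arity L f}) \<and>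
     (\<forall>r. is_fm K (rel_def \<tau> r) \<and> fv (rel_def \<tau> r) \<subseteq> {..<rel_arity L r})"

text \<open>
  Blocks of \<open>n\<close> quantifiers relativized to the domain; again the innermost one binds index 0.
  Since \<open>domain \<tau>\<close> has only the variable 0, it always speaks about the nearest quantifier.
\<close>

definition foralls_dom ::
  "('f, 'r, 'g, 's) translation \<Rightarrow> nat \<Rightarrow> ('g, 's) fm \<Rightarrow> ('g, 's) fm" where
  "foralls_dom \<tau> n = (\<lambda>p. Forall (domain \<tau> \<^bold>\<longrightarrow> p)) ^^ n"

definition exists_dom ::
  "('f, 'r, 'g, 's) translation \<Rightarrow> nat \<Rightarrow> ('g, 's) fm \<Rightarrow> ('g, 's) fm" where
  "exists_dom \<tau> n = (\<lambda>p. Exists (domain \<tau> \<^bold>\<and> p)) ^^ n"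

text \<open>\<open>at_vars xs p\<close> replaces the variable \<open>i\<close> of \<open>p\<close> by the variable \<open>xs ! i\<close>.\<close>

definition at_vars :: "nat list \<Rightarrow> ('f, 'r) fm \<Rightarrow> ('f, 'r) fm" where
  "at_vars xs = subst (\<lambda>i. Var (if i < length xs then xs ! i else i))"

text \<open>
  \<open>value_fm \<tau> k t y\<close> says that the translated term \<open>t\<close> has the value \<open>y\<close>; the variable \<open>x\<close> of \<open>t\<close> is
  read as the variable \<open>x + k\<close>. A compound term is unnested by introducing variables
  \<open>0, \<dots>, n - 1\<close> in the domain for the values of its arguments, which shifts all other variables by \<open>n\<close>.
\<close>

function value_fm ::
  "('f, 'r, 'g, 's) translation \<Rightarrow> nat \<Rightarrow> 'f tm \<Rightarrow> nat \<Rightarrow> ('g, 's) fm" where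
  "value_fm \<tau> k (Var x) y = (Var (x + k) \<^bold>= Var y)"
| "value_fm \<tau> k (Fn f ts) y =
     (let n = length ts in
      exists_dom \<tau> n
        (foldr Conj (map (\<lambda>i. value_fm \<tau> (k + n) (ts ! i) i) [0..<n])
          (at_vars ([0..<n] @ [y + n]) (fun_graph \<tau> f))))"
  by pat_completeness auto
termination
proof (relation "measure (\<lambda>(\<tau>, k, t, y). size t)", goal_cases)
  case (2 \<tau> k f ts y n i)
  then have "ts ! i \<in> set ts" by simp
  then have "size (ts ! i) < Suc (size_list size ts)"
    using size_list_estimation'[of "ts ! i" ts "size (ts ! i)" size] by simp
  then show ?case by simp
qed simp

primrec translate :: "('f, 'r, 'g, 's) translation \<Rightarrow> ('f, 'r) fm \<Rightarrow> ('g, 's) fm" where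
  "translate \<tau> Fls = Fls"
| "translate \<tau> (s \<^bold>= t) =
     exists_dom \<tau> 2 (value_fm \<tau> 2 s 0 \<^bold>\<and> value_fm \<tau> 2 t 1 \<^bold>\<and> Var 0 \<^bold>= Var 1)"
| "translate \<tau> (Rel r ts) =
     (let n = length ts in
      exists_dom \<tau> n (foldr Conj (map (\<lambda>i. value_fm \<tau> n (ts ! i) i) [0..<n]) (rel_def \<tau> r)))"
| "translate \<tau> (p \<^bold>\<longrightarrow> q) = translate \<tau> p \<^bold>\<longrightarrow> translate \<tau> q"
| "translate \<tau> (Forall p) = Forall (domain \<tau> \<^bold>\<longrightarrow> translate \<tau> p)"

definition graph_total ::
  "('f, 'r, 'g, 's) translation \<Rightarrow> nat \<Rightarrow> 'f \<Rightarrow> ('g, 's) fm" where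
  "graph_total \<tau> n f =
     foralls_dom \<tau> n (exists_dom \<tau> 1 (at_vars ([1..<Suc n] @ [0]) (fun_graph \<tau> f)))"

definition graph_functional ::
  "('f, 'r, 'g, 's) translation \<Rightarrow> nat \<Rightarrow> 'f \<Rightarrow> ('g, 's) fm" where
  "graph_functional \<tau> n f =
     foralls_dom \<tau> (n + 2)
       (at_vars ([2..<n + 2] @ [0]) (fun_graph \<tau> f) \<^bold>\<and>
        at_vars ([2..<n + 2] @ [1]) (fun_graph \<tau> f) \<^bold>\<longrightarrow> Var 0 \<^bold>= Var 1)"

definition interpretable ::
  "('f, 'r) lang \<Rightarrow> ('f, 'r) fm set \<Rightarrow> ('g, 's) lang \<Rightarrow> ('g, 's) fm set \<Rightarrow> bool" where
  "interpretable L V K U \<longleftrightarrow>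
     (\<exists>\<tau>. is_translation L K \<tau> \<and>
        (U \<turnstile>\<^bsub>K\<^esub> Exists (domain \<tau>)) \<and>
        (\<forall>f. (U \<turnstile>\<^bsub>K\<^esub> graph_total \<tau> (fun_arity L f) f) \<and>
             (U \<turnstile>\<^bsub>K\<^esub> graph_functional \<tau> (fun_arity L f) f)) \<and>
        (\<forall>p\<in>V. U \<turnstile>\<^bsub>K\<^esub> translate \<tau> p))"

section \<open>The language of finite multisets and the theory F-minus\<close>

datatype ms_fun = Empty_sym | Single_sym | Union_sym
datatype ms_rel = Sub_sym

definition ms_lang :: "(ms_fun, ms_rel) lang" where
  "ms_lang = \<lparr>fun_arity = case_ms_fun 0 1 2, rel_arity = (\<lambda>_. 2)\<rparr>"

abbreviation empty_tm :: "ms_fun tm" ("\<^bold>\<emptyset>") where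
  "\<^bold>\<emptyset> \<equiv> Fn Empty_sym []"

abbreviation single_tm :: "ms_fun tm \<Rightarrow> ms_fun tm" ("\<^bold>\<langle>_\<^bold>\<rangle>") where
  "\<^bold>\<langle>t\<^bold>\<rangle> \<equiv> Fn Single_sym [t]"

abbreviation union_tm :: "ms_fun tm \<Rightarrow> ms_fun tm \<Rightarrow> ms_fun tm" (infixr "\<^bold>\<uplus>" 65) where
  "s \<^bold>\<uplus> t \<equiv> Fn Union_sym [s, t]"

abbreviation sub_fm :: "ms_fun tm \<Rightarrow> ms_fun tm \<Rightarrow> (ms_fun, ms_rel) fm" (infix "\<^bold>\<sqsubseteq>" 60) where
  "s \<^bold>\<sqsubseteq> t \<equiv> Rel Sub_sym [s, t]"

definition F1 :: "(ms_fun, ms_rel) fm" where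
  "F1 = foralls 3 (let x = Var 2; y = Var 1; z = Var 0 in (x \<^bold>\<uplus> y) \<^bold>\<uplus> z \<^bold>= x \<^bold>\<uplus> (y \<^bold>\<uplus> z))"

definition F2 :: "(ms_fun, ms_rel) fm" where
  "F2 = foralls 2 (let x = Var 1; y = Var 0 in x \<^bold>\<uplus> y \<^bold>= y \<^bold>\<uplus> x)"

definition F3 :: "(ms_fun, ms_rel) fm" where
  "F3 = foralls 1 (let x = Var 0 in x \<^bold>\<uplus> \<^bold>\<emptyset> \<^bold>= x)"

definition F4 :: "(ms_fun, ms_rel) fm" where
  "F4 = foralls 3 (let x = Var 2; y = Var 1; z = Var 0 in x \<^bold>\<uplus> z \<^bold>= y \<^bold>\<uplus> z \<^bold>\<longrightarrow> x \<^bold>= y)"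

definition F5 :: "(ms_fun, ms_rel) fm" where
  "F5 = foralls 1 (let x = Var 0 in Neg (\<^bold>\<langle>x\<^bold>\<rangle> \<^bold>= \<^bold>\<emptyset>))"

definition F6 :: "(ms_fun, ms_rel) fm" where
  "F6 = foralls 2 (let x = Var 1; y = Var 0 in x \<^bold>\<uplus> y \<^bold>= \<^bold>\<emptyset> \<^bold>\<longrightarrow> x \<^bold>= \<^bold>\<emptyset>)"

definition F7 :: "(ms_fun, ms_rel) fm" where
  "F7 = foralls 2 (let x = Var 1; y = Var 0 in \<^bold>\<langle>x\<^bold>\<rangle> \<^bold>= \<^bold>\<langle>y\<^bold>\<rangle> \<^bold>\<longrightarrow> x \<^bold>= y)"

definition F8 :: "(ms_fun, ms_rel) fm" where
  "F8 = foralls 4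
     ((let u = Var 3; v = Var 2; x = Var 1; w = Var 0 in u \<^bold>\<uplus> v \<^bold>= \<^bold>\<langle>x\<^bold>\<rangle> \<^bold>\<uplus> w) \<^bold>\<longrightarrow>
      Exists (let u = Var 4; v = Var 3; x = Var 2; w' = Var 0 in
        u \<^bold>= \<^bold>\<langle>x\<^bold>\<rangle> \<^bold>\<uplus> w' \<^bold>\<or> v \<^bold>= \<^bold>\<langle>x\<^bold>\<rangle> \<^bold>\<uplus> w'))"

definition F9 :: "(ms_fun, ms_rel) fm" where
  "F9 = foralls 2
     (let x = Var 1; t = Var 0 in
      x \<^bold>\<sqsubseteq> t \<^bold>\<longleftrightarrow> x \<^bold>= t \<^bold>\<or>
        Exists (Exists (let x = Var 3; t = Var 2; w = Var 1; u = Var 0 in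
          t \<^bold>= w \<^bold>\<uplus> \<^bold>\<langle>u\<^bold>\<rangle> \<^bold>\<and> x \<^bold>\<sqsubseteq> u)))"

definition F_minus :: "(ms_fun, ms_rel) fm set" where
  "F_minus = {F1, F2, F3, F4, F5, F6, F7, F8, F9}"

section \<open>Hereditarily finite multisets\<close>

datatype hfm = HFM (elems: "hfm multiset")

definition hfm_empty :: hfm where
  "hfm_empty = HFM {#}"

definition hfm_single :: "hfm \<Rightarrow> hfm" where
  "hfm_single x = HFM {#x#}"

definition hfm_union :: "hfm \<Rightarrow> hfm \<Rightarrow> hfm" where
  "hfm_union x y = HFM (elems x + elems y)"

definition hfm_mem :: "hfm \<Rightarrow> hfm \<Rightarrow> bool" where
  "hfm_mem u v \<longleftrightarrow> (\<exists>w. v = hfm_union w (hfm_single u))"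

inductive hfm_sub :: "hfm \<Rightarrow> hfm \<Rightarrow> bool" for x where
  refl: "hfm_sub x x"
| step: "hfm_mem u t \<Longrightarrow> hfm_sub x u \<Longrightarrow> hfm_sub x t"

lemma hfm_mem_iff: "hfm_mem u v \<longleftrightarrow> u \<in># elems v"
proof
  assume "u \<in># elems v"
  then obtain M where "elems v = add_mset u M" by (meson multi_member_split)
  then have "v = hfm_union (HFM M) (hfm_single u)"
    by (cases v) (simp add: hfm_union_def hfm_single_def)
  then show "hfm_mem u v" unfolding hfm_mem_def ..
qed (auto simp: hfm_mem_def hfm_union_def hfm_single_def)

text \<open>The recursion on rank, which has only one solution because the rank drops along \<open>hfm_mem\<close>.\<close>

lemma hfm_sub_iff: "hfm_sub x t \<longleftrightarrow> x = t \<or> (\<exists>u. hfm_mem u t \<and> hfm_sub x u)"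
  by (subst hfm_sub.simps) auto

section \<open>Closed terms, normal forms and the theory WF-minus\<close>

datatype cterm = CEmpty | CSingle cterm | CUnion cterm cterm

primrec tm_of :: "cterm \<Rightarrow> ms_fun tm" where
  "tm_of CEmpty = \<^bold>\<emptyset>"
| "tm_of (CSingle t) = \<^bold>\<langle>tm_of t\<^bold>\<rangle>"
| "tm_of (CUnion s t) = tm_of s \<^bold>\<uplus> tm_of t"

lemma range_tm_of: "range tm_of = {t. is_tm ms_lang t \<and> fv_tm t = {}}"
proof
  have "is_tm ms_lang (tm_of t) \<and> fv_tm (tm_of t) = {}" for t
    by (induction t) (auto simp: ms_lang_def)
  then show "range tm_of \<subseteq> {t. is_tm ms_lang t \<and> fv_tm t = {}}" by blast
  have "is_tm ms_lang t \<Longrightarrow> fv_tm t = {} \<Longrightarrow> t \<in> range tm_of" for t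
  proof (induction t)
    case (Fn f ts)
    then have ts: "length ts = fun_arity ms_lang f" "set ts \<subseteq> range tm_of" by auto
    show ?case
    proof (cases f)
      case Empty_sym
      then show ?thesis using ts by (auto simp: ms_lang_def intro: range_eqI[of _ _ CEmpty])
    next
      case Single_sym
      then obtain t where "ts = [tm_of t]"
        using ts by (auto simp: ms_lang_def length_Suc_conv)
      then show ?thesis using Single_sym by (auto intro: range_eqI[of _ _ "CSingle t"])
    next
      case Union_sym
      then obtain s t where "ts = [tm_of s, tm_of t]"
        using ts by (auto simp: ms_lang_def length_Suc_conv numeral_2_eq_2)
      then show ?thesis using Union_sym by (auto intro: range_eqI[of _ _ "CUnion s t"])
    qed
  qed simp
  then show "{t. is_tm ms_lang t \<and> fv_tm t = {}} \<subseteq> range tm_of" by blast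
qed

primrec hfm_of :: "cterm \<Rightarrow> hfm" where
  "hfm_of CEmpty = hfm_empty"
| "hfm_of (CSingle t) = hfm_single (hfm_of t)"
| "hfm_of (CUnion s t) = hfm_union (hfm_of s) (hfm_of t)"

text \<open>
  The symbols are ordered as left bracket, right bracket, union, empty. Writing the union sign in
  front of its arguments makes the string determine the term although there are no parentheses.
  The order on \<open>nat list\<close> used below is the length-lexicographic one.
\<close>

primrec string_of :: "cterm \<Rightarrow> nat list" where
  "string_of CEmpty = [3]"
| "string_of (CSingle t) = [0] @ string_of t @ [1]"
| "string_of (CUnion s t) = [2] @ string_of s @ string_of t"

definition cterm_le :: "cterm \<Rightarrow> cterm \<Rightarrow> bool" (infix "\<preceq>" 50) where
  "s \<preceq> t \<longleftrightarrow> string_of s \<le> string_of t"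

fun union_of_singles :: "cterm list \<Rightarrow> cterm" where
  "union_of_singles [] = CEmpty"
| "union_of_singles [t] = CSingle t"
| "union_of_singles (t # ts) = CUnion (CSingle t) (union_of_singles ts)"

inductive normal :: "cterm \<Rightarrow> bool" where
  empty: "normal CEmpty"
| union: "ts \<noteq> [] \<Longrightarrow> \<forall>t\<in>set ts. normal t \<Longrightarrow> sorted_wrt (\<preceq>) ts \<Longrightarrow> normal (union_of_singles ts)"

text \<open>\<open>flatten t\<close> lists the \<open>r\<close> for the factors \<open>\<langle>r\<rangle>\<close> of \<open>t\<close>, dropping empty factors.\<close>

primrec flatten :: "cterm \<Rightarrow> cterm list" where
  "flatten CEmpty = []"
| "flatten (CSingle t) = [t]"
| "flatten (CUnion s t) = flatten s @ flatten t"

primrec nf :: "cterm \<Rightarrow> cterm" where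
  "nf CEmpty = CEmpty"
| "nf (CSingle t) = CSingle (nf t)"
| "nf (CUnion s t) = union_of_singles (sort_key string_of (flatten (nf s) @ flatten (nf t)))"

definition hull :: "cterm \<Rightarrow> cterm set" where
  "hull t = {s. normal s \<and> hfm_sub (hfm_of s) (hfm_of t)}"

definition hull_list :: "cterm \<Rightarrow> cterm list" where
  "hull_list t = sorted_key_list_of_set string_of (hull t)"

definition W1 :: "cterm \<Rightarrow> cterm \<Rightarrow> (ms_fun, ms_rel) fm" where
  "W1 s t = Neg (tm_of s \<^bold>= tm_of t)"

definition W2 :: "cterm \<Rightarrow> (ms_fun, ms_rel) fm" where
  "W2 t = Forall (Var 0 \<^bold>\<sqsubseteq> tm_of t \<^bold>\<longleftrightarrow>
     disj_list (map (\<lambda>s. Var 0 \<^bold>= tm_of s) (hull_list t)))"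

definition WF_minus :: "(ms_fun, ms_rel) fm set" where
  "WF_minus = {F1, F2, F3} \<union> {W1 s t | s t. nf s \<noteq> nf t} \<union> range W2"

subsection \<open>Finiteness of hulls, correctness of normal forms\<close>

lemma string_of_append_inject:
  "string_of s @ xs = string_of t @ ys \<Longrightarrow> s = t \<and> xs = ys"
proof (induction s arbitrary: t xs ys)
  case CEmpty
  then show ?case by (cases t) auto
next
  case (CSingle s)
  from CSingle.prems obtain t' where t: "t = CSingle t'" by (cases t) auto
  with CSingle.prems have "string_of s @ 1 # xs = string_of t' @ 1 # ys" by simp
  then have "s = t' \<and> 1 # xs = 1 # ys" by (rule CSingle.IH)
  then show ?case using t by simp
next
  case (CUnion s1 s2)
  from CUnion.prems obtain t1 t2 where t: "t = CUnion t1 t2" by (cases t) auto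
  with CUnion.prems have
    "string_of s1 @ (string_of s2 @ xs) = string_of t1 @ (string_of t2 @ ys)" by simp
  then have *: "s1 = t1 \<and> string_of s2 @ xs = string_of t2 @ ys" by (rule CUnion.IH(1))
  then have "s2 = t2 \<and> xs = ys" by (intro CUnion.IH(2)) simp
  then show ?case using * t by simp
qed

lemma inj_string_of: "inj string_of"
  using string_of_append_inject[of _ "[]" _ "[]"] by (auto intro: injI)

lemma sorted_wrt_cterm_le: "sorted_wrt (\<preceq>) ts \<longleftrightarrow> sorted (map string_of ts)"
  by (simp add: cterm_le_def[abs_def] sorted_wrt_map)

lemma elems_union_of_singles:
  "elems (hfm_of (union_of_singles ts)) = mset (map hfm_of ts)"
  by (induction ts rule: union_of_singles.induct)
    (auto simp: hfm_empty_def hfm_single_def hfm_union_def)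

lemma normalE:
  assumes "normal t"
  obtains ts where "t = union_of_singles ts" "\<forall>s\<in>set ts. normal s" "sorted_wrt (\<preceq>) ts"
  using assms
proof cases
  case empty
  then show ?thesis using that[of "[]"] by simp
qed (rule that)

lemma size_union_of_singles: "t \<in> set ts \<Longrightarrow> size t < size (union_of_singles ts)"
  by (induction ts rule: union_of_singles.induct) auto

lemma normal_hfm_of_inject:
  "normal s \<Longrightarrow> normal t \<Longrightarrow> hfm_of s = hfm_of t \<Longrightarrow> s = t"
proof (induction "size s" arbitrary: s t rule: less_induct)
  case less
  obtain ss where ss: "s = union_of_singles ss" "\<forall>s\<in>set ss. normal s" "sorted_wrt (\<preceq>) ss"
    using less.prems(1) by (rule normalE)
  obtain ts where ts: "t = union_of_singles ts" "\<forall>s\<in>set ts. normal s" "sorted_wrt (\<preceq>) ts"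
    using less.prems(2) by (rule normalE)
  have IH: "a = b" if "a \<in> set ss" "normal b" "hfm_of a = hfm_of b" for a b
    using less.hyps[of a b] that ss size_union_of_singles by blast
  have eq: "mset (map hfm_of ss) = mset (map hfm_of ts)"
    using less.prems(3) elems_union_of_singles[of ss] elems_union_of_singles[of ts] ss(1) ts(1) by simp
  have img: "hfm_of ` set ss = hfm_of ` set ts"
    using mset_eq_setD[OF eq] by simp
  have sub: "set ts \<subseteq> set ss"
  proof
    fix b assume b: "b \<in> set ts"
    then have "hfm_of b \<in> hfm_of ` set ss"
      using img by simp
    then obtain a where "a \<in> set ss" "hfm_of a = hfm_of b" by (metis imageE)
    then show "b \<in> set ss" using IH[of a b] b ts(2) by simp
  qed
  have inj: "inj_on hfm_of (set ss)"
    using IH ss(2) by (auto intro: inj_onI)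
  define g where "g = inv_into (set ss) hfm_of"
  have g: "map g (map hfm_of rs) = rs" if "set rs \<subseteq> set ss" for rs
    using inj that by (auto simp: g_def intro!: map_idI)
  have "mset ss = mset ts"
  proof -
    have "mset (map g (map hfm_of ss)) = mset (map g (map hfm_of ts))"
      unfolding mset_map[of g] eq ..
    then show ?thesis unfolding g[OF order_refl] g[OF sub] .
  qed
  then have "mset (map string_of ss) = mset (map string_of ts)" by simp
  moreover have "sorted (map string_of ss)" "sorted (map string_of ts)"
    using ss(3) ts(3) by (simp_all only: sorted_wrt_cterm_le)
  ultimately have "map string_of ss = map string_of ts"
    using properties_for_sort sorted_sort_id by fastforce
  then have "ss = ts" unfolding inj_map_eq_map[OF inj_string_of] .
  then show ?case using ss(1) ts(1) by simp
qed

lemma finite_hfm_sub: "finite {x. hfm_sub x t}"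
proof (induction t)
  case (HFM M)
  have "{x. hfm_sub x (HFM M)} = insert (HFM M) (\<Union>u\<in>set_mset M. {x. hfm_sub x u})"
    using hfm_sub_iff[of _ "HFM M"] by (auto simp: hfm_mem_iff)
  then show ?case using HFM by simp
qed

lemma finite_hull: "finite (hull t)"
proof (rule finite_imageD)
  show "finite (hfm_of ` hull t)"
    by (rule finite_subset[OF _ finite_hfm_sub[of "hfm_of t"]]) (auto simp: hull_def)
  show "inj_on hfm_of (hull t)"
    by (auto simp: hull_def intro: inj_onI normal_hfm_of_inject)
qed

lemma (in linorder) set_sorted_key_list_of_set_inj:
  assumes "inj_on f A" and "finite A"
  shows "set (sorted_key_list_of_set f A) = A"
proof -
  interpret folding_insort_key "(\<le>)" "(<)" A f
    by unfold_locales (rule assms(1))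
  show ?thesis using assms(2) by simp
qed

lemma set_hull_list: "set (hull_list t) = hull t"
  unfolding hull_list_def
  by (intro set_sorted_key_list_of_set_inj finite_hull) (rule inj_on_subset[OF inj_string_of], simp)

lemma hfm_of_nf: "hfm_of (nf t) = hfm_of t"
proof (induction t)
  case (CUnion s t)
  have fl: "mset (map hfm_of (flatten r)) = elems (hfm_of r)" for r
    by (induction r) (simp_all add: hfm_empty_def hfm_single_def hfm_union_def)
  have "elems (hfm_of (nf (CUnion s t))) = elems (hfm_of (CUnion s t))"
    using fl[of "nf s"] fl[of "nf t"] CUnion
    by (simp add: elems_union_of_singles hfm_union_def)
  then show ?case by (simp add: hfm.expand)
qed simp_all

lemma normal_union_of_singles:
  "\<forall>t\<in>set ts. normal t \<Longrightarrow> sorted_wrt (\<preceq>) ts \<Longrightarrow> normal (union_of_singles ts)"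
  by (cases "ts = []") (simp_all add: normal.intros)

lemma normal_nf: "normal (nf t)"
proof (induction t)
  case (CSingle t)
  then show ?case using normal_union_of_singles[of "[nf t]"] by simp
next
  case (CUnion s t)
  have "flatten (union_of_singles ts) = ts" for ts
    by (induction ts rule: union_of_singles.induct) simp_all
  then have "\<forall>q\<in>set (flatten r). normal q" if "normal r" for r
    using that by (auto elim!: normalE)
  then show ?case
    using CUnion unfolding nf.simps
    by (intro normal_union_of_singles) (auto simp: sorted_wrt_cterm_le)
qed (simp add: normal.empty)

section \<open>The arithmetical theory R\<close>

datatype arith_fun = Zero_sym | Succ_sym | Plus_sym | Times_sym
datatype arith_rel = Le_sym

definition arith_lang :: "(arith_fun, arith_rel) lang" where
  "arith_lang = \<lparr>fun_arity = case_arith_fun 0 1 2 2, rel_arity = (\<lambda>_. 2)\<rparr>"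

primrec num :: "nat \<Rightarrow> arith_fun tm" where
  "num 0 = Fn Zero_sym []"
| "num (Suc n) = Fn Succ_sym [num n]"

definition R_theory :: "(arith_fun, arith_rel) fm set" where
  "R_theory =
     {Fn Plus_sym [num n, num m] \<^bold>= num (n + m) | n m. True} \<union>
     {Fn Times_sym [num n, num m] \<^bold>= num (n * m) | n m. True} \<union>
     {Neg (num n \<^bold>= num m) | n m. n \<noteq> m} \<union>
     {Forall (Rel Le_sym [Var 0, num n] \<^bold>\<longleftrightarrow> disj_list (map (\<lambda>i. Var 0 \<^bold>= num i) [0..<Suc n]))
       | n. True} \<union>
     {Forall (Rel Le_sym [Var 0, num n] \<^bold>\<or> Rel Le_sym [num n, Var 0]) | n. True}"

section \<open>All three theories consist of sentences\<close>

lemma is_fm_disj_list: "(\<forall>p\<in>set ps. is_fm L p) \<Longrightarrow> is_fm L (disj_list ps)"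
  by (induction ps rule: disj_list.induct) auto

lemma fv_disj_list: "fv (disj_list ps) = (\<Union>p\<in>set ps. fv p)"
  by (induction ps rule: disj_list.induct) auto

lemma is_tm_tm_of [simp]: "is_tm ms_lang (tm_of t)" and fv_tm_of [simp]: "fv_tm (tm_of t) = {}"
  using range_tm_of by blast+

lemma F_minus_sentences: "F_minus \<subseteq> sentences ms_lang"
  by (auto simp: F_minus_def F1_def F2_def F3_def F4_def F5_def F6_def F7_def F8_def F9_def
      foralls_def sentences_def ms_lang_def Let_def numeral_eq_Suc less_Suc_eq)

lemma WF_minus_sentences: "WF_minus \<subseteq> sentences ms_lang"
proof -
  have "W2 t \<in> sentences ms_lang" for t
    by (auto simp: W2_def sentences_def fv_disj_list intro!: is_fm_disj_list)
      (simp_all add: ms_lang_def)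
  moreover have "W1 s t \<in> sentences ms_lang" for s t
    by (simp add: W1_def sentences_def)
  ultimately show ?thesis
    using F_minus_sentences unfolding WF_minus_def F_minus_def by blast
qed

lemma R_theory_sentences: "R_theory \<subseteq> sentences arith_lang"
proof -
  have "is_tm arith_lang (num n)" "fv_tm (num n) = {}" for n
    by (induction n) (simp_all add: arith_lang_def)
  then show ?thesis
    by (auto simp: R_theory_def sentences_def fv_disj_list intro!: is_fm_disj_list)
      (simp_all add: arith_lang_def split: if_splits)
qed

end

theory Submission
  imports Defs
begin

text \<open>
  Both parts rest on compactness, so that only finitely many axioms are used in each derivation.

  (i) A finite part of \<open>WF_minus\<close> has a model in which \<open>\<langle>x\<rangle>\<close> is the true singleton for only finitely
  many \<open>x\<close> and empty otherwise. There the terms \<open>\<langle>t\<rangle>\<close> take finitely many values, hence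
  some instance of \<open>W1\<close> fails.

  (ii) A finite part of \<open>R_theory\<close> has a finite model, namely \<open>{0, \<dots>, N}\<close> with the operations cut off
  at \<open>N\<close>. An interpretation of \<open>F_minus\<close> would produce from it a finite model of \<open>F_minus\<close>. But in a
  finite cancellative structure \<open>y \<mapsto> y \<uplus> \<langle>\<emptyset>\<rangle>\<close> is surjective, so \<open>\<langle>\<emptyset>\<rangle>\<close> is a summand of \<open>\<emptyset>\<close>,
  which contradicts \<open>F5\<close> and \<open>F6\<close>.
\<close>

section \<open>Semantics, soundness and compactness\<close>

fun eval_tm :: "('f \<Rightarrow> 'a list \<Rightarrow> 'a) \<Rightarrow> (nat \<Rightarrow> 'a) \<Rightarrow> 'f tm \<Rightarrow> 'a" where
  "eval_tm I e (Var x) = e x"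
| "eval_tm I e (Fn f ts) = I f (map (eval_tm I e) ts)"

text \<open>The universe is a set and not a type, so that the domain of an interpretation can serve
  as a universe too. Only quantifiers look at \<open>D\<close>; that environments and functions stay
  inside it is demanded separately.\<close>

primrec sat :: "'a set \<Rightarrow> ('f \<Rightarrow> 'a list \<Rightarrow> 'a) \<Rightarrow> ('r \<Rightarrow> 'a list \<Rightarrow> bool) \<Rightarrow>
    (nat \<Rightarrow> 'a) \<Rightarrow> ('f, 'r) fm \<Rightarrow> bool" where
  "sat D I J e Fls \<longleftrightarrow> False"
| "sat D I J e (s \<^bold>= t) \<longleftrightarrow> eval_tm I e s = eval_tm I e t"
| "sat D I J e (Rel r ts) \<longleftrightarrow> J r (map (eval_tm I e) ts)"
| "sat D I J e (p \<^bold>\<longrightarrow> q) \<longleftrightarrow> (sat D I J e p \<longrightarrow> sat D I J e q)"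
| "sat D I J e (Forall p) \<longleftrightarrow> (\<forall>a\<in>D. sat D I J (case_nat a e) p)"

section \<open>Coincidence and substitution\<close>

lemma eval_tm_cong: "(\<And>x. x \<in> fv_tm t \<Longrightarrow> e x = e' x) \<Longrightarrow> eval_tm I e t = eval_tm I e' t"
proof (induction t)
  case (Fn f ts)
  then have "map (eval_tm I e) ts = map (eval_tm I e') ts" by auto
  then show ?case by (simp only: eval_tm.simps)
qed simp

lemma sat_cong: "(\<And>x. x \<in> fv p \<Longrightarrow> e x = e' x) \<Longrightarrow> sat D I J e p = sat D I J e' p"
proof (induction p arbitrary: e e')
  case (Eq s t)
  then have "eval_tm I e s = eval_tm I e' s" "eval_tm I e t = eval_tm I e' t"
    by (auto intro!: eval_tm_cong)
  then show ?case by simp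
next
  case (Rel r ts)
  then have "map (eval_tm I e) ts = map (eval_tm I e') ts" by (auto intro!: eval_tm_cong)
  then show ?case by (simp only: sat.simps)
next
  case (Imp p q)
  have "sat D I J e p = sat D I J e' p" by (rule Imp.IH) (use Imp.prems in simp)
  moreover have "sat D I J e q = sat D I J e' q" by (rule Imp.IH) (use Imp.prems in simp)
  ultimately show ?case by simp
next
  case (Forall p)
  have "sat D I J (case_nat a e) p = sat D I J (case_nat a e') p" for a
    by (rule Forall.IH) (use Forall.prems in \<open>auto split: nat.split\<close>)
  then show ?case by simp
qed simp

lemma eval_subst_tm:
  "eval_tm I e (subst_tm \<sigma> t) = eval_tm I (\<lambda>x. eval_tm I e (\<sigma> x)) t"
proof (induction t)
  case (Fn f ts)
  then have "map (eval_tm I e \<circ> subst_tm \<sigma>) ts = map (eval_tm I (\<lambda>x. eval_tm I e (\<sigma> x))) ts" by simp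
  then show ?case by (simp only: subst_tm.simps eval_tm.simps map_map)
qed simp

lemma sat_subst: "sat D I J e (subst \<sigma> p) = sat D I J (\<lambda>x. eval_tm I e (\<sigma> x)) p"
proof (induction p arbitrary: e \<sigma>)
  case (Rel r ts)
  have "map (eval_tm I e \<circ> subst_tm \<sigma>) ts = map (eval_tm I (\<lambda>x. eval_tm I e (\<sigma> x))) ts"
    by (simp add: eval_subst_tm)
  then show ?case by (simp only: subst.simps sat.simps map_map)
next
  case (Forall p)
  have "(\<lambda>x. eval_tm I (case_nat a e) (under_binder \<sigma> x)) = case_nat a (\<lambda>x. eval_tm I e (\<sigma> x))" for a
    by (auto simp: fun_eq_iff under_binder_def eval_subst_tm split: nat.split)
  then show ?case by (simp add: Forall)
qed (simp_all add: eval_subst_tm)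

lemma sat_inst: "sat D I J e (inst t p) = sat D I J (case_nat (eval_tm I e t) e) p"
proof -
  have "(\<lambda>x. eval_tm I e (case_nat t Var x)) = case_nat (eval_tm I e t) e"
    by (auto simp: fun_eq_iff split: nat.split)
  then show ?thesis by (simp add: inst_def sat_subst)
qed

lemma sat_lift: "sat D I J (case_nat a e) (lift p) = sat D I J e p"
  by (simp add: lift_def sat_subst)

lemma sat_disj_list: "sat D I J e (disj_list ps) \<longleftrightarrow> (\<exists>p\<in>set ps. sat D I J e p)"
  by (induction ps rule: disj_list.induct) auto

lemma sat_foldr_Conj:
  "sat D I J e (foldr Conj ps q) \<longleftrightarrow> (\<forall>p\<in>set ps. sat D I J e p) \<and> sat D I J e q"
  by (induction ps) auto

lemma ball_map_upt: "(\<forall>x\<in>set (map g [0..<n]). P x) \<longleftrightarrow> (\<forall>i<n. P (g i))"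
  by auto

section \<open>Soundness\<close>

definition closed_under :: "('f, 'r) lang \<Rightarrow> 'a set \<Rightarrow> ('f \<Rightarrow> 'a list \<Rightarrow> 'a) \<Rightarrow> bool" where
  "closed_under L D I \<longleftrightarrow> (\<forall>f as. length as = fun_arity L f \<longrightarrow> set as \<subseteq> D \<longrightarrow> I f as \<in> D)"

lemma eval_tm_in:
  "closed_under L D I \<Longrightarrow> \<forall>x. e x \<in> D \<Longrightarrow> is_tm L t \<Longrightarrow> eval_tm I e t \<in> D"
proof (induction t)
  case (Fn f ts)
  then have "set (map (eval_tm I e) ts) \<subseteq> D" by auto
  then show ?case using Fn.prems by (simp add: closed_under_def)
qed simp

text \<open>Induction for all environments, because \<open>ForallI\<close> passes to
  \<open>case_nat a e\<close>. Closure makes \<open>ForallE\<close> sound: the instantiating term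
  must have its value in \<open>D\<close>.\<close>

lemma soundness:
  assumes "\<Gamma> \<turnstile>\<^bsub>L\<^esub> p" and "closed_under L D I" and "\<forall>x. e x \<in> D" and "\<forall>q\<in>\<Gamma>. sat D I J e q"
  shows "sat D I J e p"
  using assms
proof (induction arbitrary: e rule: derives.induct)
  case (ForallI \<Gamma> L p)
  have "sat D I J (case_nat a e) p" if "a \<in> D" for a
    using ForallI.prems that by (intro ForallI.IH) (auto simp: sat_lift split: nat.split)
  then show ?case by simp
next
  case (ForallE \<Gamma> L p t)
  have "sat D I J e (Forall p)" using ForallE.IH ForallE.prems by blast
  moreover have "eval_tm I e t \<in> D" using ForallE.prems ForallE.hyps by (intro eval_tm_in)
  ultimately show ?case by (simp add: sat_inst)
next
  case (Contr p \<Gamma> L)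
  show ?case
  proof (rule ccontr)
    assume "\<not> sat D I J e p"
    then have "sat D I J e Fls" using Contr.prems by (intro Contr.IH) auto
    then show False by simp
  qed
next
  case (EqE \<Gamma> L s t p)
  have "sat D I J e (s \<^bold>= t)" "sat D I J e (inst s p)"
    using EqE.IH EqE.prems by blast+
  then show ?case by (simp add: sat_inst)
next
  case (ImpI p \<Gamma> L q)
  have "sat D I J e q" if "sat D I J e p"
    using ImpI.prems that by (intro ImpI.IH) auto
  then show ?case by simp
next
  case (ImpE \<Gamma> L p q)
  have "sat D I J e (p \<^bold>\<longrightarrow> q)" "sat D I J e p"
    using ImpE.IH ImpE.prems by blast+
  then show ?case by simp
qed simp_all

section \<open>Monotonicity and compactness of derivability\<close>

lemma derives_mono: "\<Gamma> \<turnstile>\<^bsub>L\<^esub> p \<Longrightarrow> \<Gamma> \<subseteq> \<Delta> \<Longrightarrow> \<Delta> \<turnstile>\<^bsub>L\<^esub> p"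
proof (induction arbitrary: \<Delta> rule: derives.induct)
  case (ImpI p \<Gamma> L q)
  then show ?case by (meson derives.ImpI insert_mono)
next
  case (Contr p \<Gamma> L)
  then show ?case by (meson derives.Contr insert_mono)
next
  case (ForallI \<Gamma> L p)
  then show ?case by (meson derives.ForallI image_mono)
next
  case (ForallE \<Gamma> L p t)
  then show ?case by (meson derives.ForallE)
next
  case (EqE \<Gamma> L s t p)
  then show ?case using derives.EqE[of \<Delta> L s t p] by blast
next
  case (ImpE \<Gamma> L p q)
  then show ?case using derives.ImpE[of \<Delta> L p q] by blast
qed (auto intro: derives.Ax derives.EqI)

text \<open>For \<open>ImpI\<close> and \<open>Contr\<close>, whose premises carry one extra
  hypothesis.\<close>

lemma finite_subset_insert:
  assumes "finite F" and "F \<subseteq> insert p \<Gamma>"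
  obtains G where "finite G" "G \<subseteq> \<Gamma>" "F \<subseteq> insert p G"
  using assms by (intro that[of "F - {p}"]) auto

text \<open>A derivation is a finite tree: unite the hypotheses used by the premises and weaken with
  \<open>derives_mono\<close>. For \<open>ForallI\<close>, a finite part of the lifted hypotheses is
  the image of a finite part of the original ones.\<close>

lemma derives_compact: "\<Gamma> \<turnstile>\<^bsub>L\<^esub> p \<Longrightarrow> \<exists>F. finite F \<and> F \<subseteq> \<Gamma> \<and> (F \<turnstile>\<^bsub>L\<^esub> p)"
proof (induction rule: derives.induct)
  case (Ax p \<Gamma> L)
  then show ?case by (intro exI[of _ "{p}"]) (auto intro: derives.Ax)
next
  case (ImpI p \<Gamma> L q)
  then obtain F where F: "finite F" "F \<subseteq> insert p \<Gamma>" "F \<turnstile>\<^bsub>L\<^esub> q" by blast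
  obtain G where "finite G" "G \<subseteq> \<Gamma>" "F \<subseteq> insert p G" using finite_subset_insert[OF F(1,2)] .
  then show ?case using F(3) ImpI.hyps by (meson derives.ImpI derives_mono)
next
  case (Contr p \<Gamma> L)
  then obtain F where F: "finite F" "F \<subseteq> insert (Neg p) \<Gamma>" "F \<turnstile>\<^bsub>L\<^esub> Fls" by blast
  obtain G where "finite G" "G \<subseteq> \<Gamma>" "F \<subseteq> insert (Neg p) G" using finite_subset_insert[OF F(1,2)] .
  then show ?case using F(3) Contr.hyps by (meson derives.Contr derives_mono)
next
  case (ForallI \<Gamma> L p)
  then obtain F where F: "finite F" "F \<subseteq> lift ` \<Gamma>" "F \<turnstile>\<^bsub>L\<^esub> p" by blast
  then obtain G where "finite G" "G \<subseteq> \<Gamma>" "F = lift ` G" by (meson finite_subset_image)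
  then show ?case using F(3) by (blast intro: derives.ForallI)
next
  case (ImpE \<Gamma> L p q)
  then obtain F G where "finite F" "F \<subseteq> \<Gamma>" "F \<turnstile>\<^bsub>L\<^esub> p \<^bold>\<longrightarrow> q" "finite G" "G \<subseteq> \<Gamma>" "G \<turnstile>\<^bsub>L\<^esub> p"
    by blast
  moreover from this have "F \<union> G \<turnstile>\<^bsub>L\<^esub> q"
    by (meson derives.ImpE derives_mono Un_upper1 Un_upper2)
  ultimately show ?case by (meson finite_UnI Un_least)
next
  case (EqE \<Gamma> L s t p)
  then obtain F G where "finite F" "F \<subseteq> \<Gamma>" "F \<turnstile>\<^bsub>L\<^esub> s \<^bold>= t" "finite G" "G \<subseteq> \<Gamma>" "G \<turnstile>\<^bsub>L\<^esub> inst s p"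
    by blast
  moreover from this have "F \<union> G \<turnstile>\<^bsub>L\<^esub> inst t p"
    using derives.EqE[of "F \<union> G" L s t p] derives_mono[of _ L _ "F \<union> G"] by blast
  ultimately show ?case by (meson finite_UnI Un_least)
next
  case (ForallE \<Gamma> L p t)
  then show ?case by (meson derives.ForallE)
next
  case (EqI L t \<Gamma>)
  then show ?case using derives.EqI[of L t "{}"] by blast
qed

text \<open>One finite set must serve all of \<open>A\<close> at once, since a single structure is
  to be chosen for it later.\<close>

lemma derives_compact_finite:
  assumes "finite A" and "\<forall>p\<in>A. \<Gamma> \<turnstile>\<^bsub>L\<^esub> p"
  obtains F where "finite F" "F \<subseteq> \<Gamma>" "\<forall>p\<in>A. F \<turnstile>\<^bsub>L\<^esub> p"
proof -
  have "\<forall>p\<in>A. \<exists>F. finite F \<and> F \<subseteq> \<Gamma> \<and> (F \<turnstile>\<^bsub>L\<^esub> p)"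
    using assms(2) derives_compact by blast
  then obtain F where F: "\<forall>p\<in>A. finite (F p) \<and> F p \<subseteq> \<Gamma> \<and> (F p \<turnstile>\<^bsub>L\<^esub> p)" by metis
  show ?thesis
  proof (rule that)
    show "finite (\<Union>p\<in>A. F p)" "(\<Union>p\<in>A. F p) \<subseteq> \<Gamma>" using assms(1) F by auto
    show "\<forall>p\<in>A. (\<Union>p\<in>A. F p) \<turnstile>\<^bsub>L\<^esub> p" using F by (meson UN_upper derives_mono)
  qed
qed

section \<open>Models of finite parts of WF-minus\<close>

text \<open>\<open>S\<close> holds the arguments at which singletons are genuine; with
  \<open>UNIV\<close> these are the standard operations. The last equation interprets
  \<open>Empty_sym\<close> and is also the default for lists of the wrong length.\<close>

fun hfm_fun :: "hfm set \<Rightarrow> ms_fun \<Rightarrow> hfm list \<Rightarrow> hfm" where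
  "hfm_fun S Single_sym [x] = (if x \<in> S then hfm_single x else hfm_empty)"
| "hfm_fun S Union_sym [x, y] = hfm_union x y"
| "hfm_fun S _ _ = hfm_empty"

fun hfm_rel :: "ms_rel \<Rightarrow> hfm list \<Rightarrow> bool" where
  "hfm_rel Sub_sym [x, y] = hfm_sub x y"
| "hfm_rel Sub_sym _ = False"

abbreviation hfm_sat :: "hfm set \<Rightarrow> (ms_fun, ms_rel) fm \<Rightarrow> bool" where
  "hfm_sat S \<equiv> sat UNIV (hfm_fun S) hfm_rel (\<lambda>_. hfm_empty)"

primrec single_args :: "cterm \<Rightarrow> hfm set" where
  "single_args CEmpty = {}"
| "single_args (CSingle t) = insert (hfm_of t) (single_args t)"
| "single_args (CUnion s t) = single_args s \<union> single_args t"

lemma finite_single_args: "finite (single_args t)"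
  by (induction t) auto

text \<open>Every singleton formed while evaluating \<open>t\<close> is then genuine, so the
  collapse is never met.\<close>

lemma eval_tm_of: "single_args t \<subseteq> S \<Longrightarrow> eval_tm (hfm_fun S) e (tm_of t) = hfm_of t"
  by (induction t) auto

text \<open>By induction the elements have names, and \<open>union_of_singles\<close> of these names
  denotes the multiset.\<close>

lemma surj_hfm_of: "\<exists>t. hfm_of t = x"
proof (induction x)
  case (HFM M)
  obtain xs where xs: "M = mset xs" by (metis ex_mset)
  from HFM obtain g where g: "\<forall>x\<in>#M. hfm_of (g x) = x" by metis
  have "map hfm_of (map g xs) = xs" using g xs by (auto intro!: map_idI)
  then have "elems (hfm_of (union_of_singles (map g xs))) = M"
    unfolding elems_union_of_singles xs by simp
  then show ?case by (metis hfm.exhaust_sel)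
qed

lemma infinite_hfm: "infinite (UNIV :: hfm set)"
proof
  assume "finite (UNIV :: hfm set)"
  moreover have "inj (\<lambda>n. HFM (replicate_mset n hfm_empty))"
    by (rule injI) (metis hfm.inject size_replicate_mset)
  ultimately show False using finite_imageD finite_subset infinite_UNIV_nat subset_UNIV by metis
qed

text \<open>This is why the disjunction in \<open>W2\<close> is exhaustive: whatever lies below the
  value of \<open>t\<close> has a name, and the normal form of that name is in the hull.\<close>

lemma hull_values:
  "{x. hfm_sub x (hfm_of t)} = hfm_of ` hull t"
proof -
  have "x \<in> hfm_of ` hull t" if "hfm_sub x (hfm_of t)" for x
  proof -
    obtain s where "hfm_of s = x" using surj_hfm_of by blast
    then show ?thesis
      using that normal_nf[of s] hfm_of_nf[of s] by (intro image_eqI[of _ _ "nf s"]) (auto simp: hull_def)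
  qed
  then show ?thesis by (auto simp: hull_def)
qed

text \<open>\<open>F1\<close>, \<open>F2\<close> and \<open>F3\<close> do not mention singletons and
  hold for every \<open>S\<close>; an instance of \<open>W1\<close> or \<open>W2\<close> mentions
  finitely many closed terms, hence forms finitely many singletons. Quantifying over all larger
  \<open>S'\<close> lets the supports of several axioms be united.\<close>

lemma WF_minus_finite_support:
  assumes "p \<in> WF_minus"
  shows "\<exists>S. finite S \<and> (\<forall>S'. S \<subseteq> S' \<longrightarrow> hfm_sat S' p)"
proof -
  consider "p \<in> {F1, F2, F3}" | s t where "p = W1 s t" "nf s \<noteq> nf t" | t where "p = W2 t"
    using assms unfolding WF_minus_def by blast
  then show ?thesis
  proof cases
    case 1
    have "hfm_sat S' p" for S'
      using 1 by (auto simp: F1_def F2_def F3_def foralls_def Let_def numeral_eq_Suc hfm_union_def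
          hfm_empty_def ac_simps)
    then show ?thesis by blast
  next
    case 2
    \<comment> \<open>Different normal terms have different values, and \<open>nf\<close> preserves
      values.\<close>
    then have "hfm_of s \<noteq> hfm_of t"
      by (metis hfm_of_nf normal_hfm_of_inject normal_nf)
    then show ?thesis using 2
      by (intro exI[of _ "single_args s \<union> single_args t"])
        (simp add: finite_single_args W1_def eval_tm_of)
  next
    case 3
    \<comment> \<open>The terms in the disjunction have to be evaluated correctly as well as
      \<open>t\<close>.\<close>
    let ?S = "single_args t \<union> (\<Union>s\<in>hull t. single_args s)"
    have "hfm_sat S' p" if S': "?S \<subseteq> S'" for S'
    proof -
      have t: "eval_tm (hfm_fun S') e (tm_of t) = hfm_of t" for e
        using S' by (intro eval_tm_of) simp
      have s: "eval_tm (hfm_fun S') e (tm_of s) = hfm_of s" if "s \<in> hull t" for e s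
        using S' that by (intro eval_tm_of) blast
      have "hfm_sub x (hfm_of t) \<longleftrightarrow> (\<exists>s\<in>hull t. x = hfm_of s)" for x
        using hull_values[of t] by blast
      then show ?thesis by (simp add: 3 W2_def sat_disj_list set_hull_list t s)
    qed
    moreover have "finite ?S" by (simp add: finite_single_args finite_hull)
    ultimately show ?thesis by blast
  qed
qed

text \<open>Pigeonhole: the infinitely many terms \<open>CSingle (g x)\<close> share finitely many
  values in the collapsed structure, while their true values differ.\<close>

lemma finite_W1_fails:
  assumes "finite S"
  shows "\<exists>s t. nf s \<noteq> nf t \<and> \<not> hfm_sat S (W1 s t)"
proof -
  obtain g where g: "\<And>x. hfm_of (g x) = x" using surj_hfm_of by metis
  define v where "v x = eval_tm (hfm_fun S) (\<lambda>_. hfm_empty) (tm_of (CSingle (g x)))" for x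
  \<comment> \<open>The inner term may be evaluated wrongly; the outermost singleton alone forces a
    value that is empty or the singleton of an element of \<open>S\<close>.\<close>
  have "range v \<subseteq> insert hfm_empty (hfm_single ` S)" by (auto simp: v_def)
  then have "finite (range v)" using assms by (meson finite.insertI finite_imageI finite_subset)
  then have "\<not> inj v" using infinite_hfm finite_imageD by blast
  then obtain x y where xy: "x \<noteq> y" "v x = v y" unfolding inj_def by blast
  have "hfm_of (nf (CSingle (g x))) \<noteq> hfm_of (nf (CSingle (g y)))"
    using xy(1) unfolding hfm_of_nf by (simp add: g hfm_single_def)
  then have "nf (CSingle (g x)) \<noteq> nf (CSingle (g y))" by metis
  then show ?thesis using xy(2) by (auto simp: W1_def v_def simp del: nf.simps tm_of.simps)
qed

text \<open>A finite axiomatization \<open>A\<close> would follow from a finite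
  \<open>F \<subseteq> WF_minus\<close>. A collapsed structure satisfying \<open>F\<close> satisfies
  \<open>A\<close>, hence every axiom of \<open>WF_minus\<close>, against the failing instance of
  \<open>W1\<close>.\<close>

lemma not_finitely_axiomatizable_WF_minus: "\<not> finitely_axiomatizable ms_lang WF_minus"
proof
  assume "finitely_axiomatizable ms_lang WF_minus"
  then obtain A where A: "finite A" "A \<subseteq> sentences ms_lang"
    and eq: "\<forall>p\<in>sentences ms_lang. (A \<turnstile>\<^bsub>ms_lang\<^esub> p) \<longleftrightarrow> (WF_minus \<turnstile>\<^bsub>ms_lang\<^esub> p)"
    unfolding finitely_axiomatizable_def by blast
  have "\<forall>p\<in>A. WF_minus \<turnstile>\<^bsub>ms_lang\<^esub> p"
  proof
    fix p assume "p \<in> A"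
    then show "WF_minus \<turnstile>\<^bsub>ms_lang\<^esub> p"
      using A(2) eq derives.Ax[of p A ms_lang] by (auto simp: sentences_def)
  qed
  then obtain F where F: "finite F" "F \<subseteq> WF_minus" "\<forall>p\<in>A. F \<turnstile>\<^bsub>ms_lang\<^esub> p"
    using derives_compact_finite[OF A(1)] by blast
  have "\<forall>p\<in>F. \<exists>S. finite S \<and> (\<forall>S'. S \<subseteq> S' \<longrightarrow> hfm_sat S' p)"
    using F(2) WF_minus_finite_support by blast
  then obtain S where S: "\<forall>p\<in>F. finite (S p) \<and> (\<forall>S'. S p \<subseteq> S' \<longrightarrow> hfm_sat S' p)" by metis
  define T where "T = (\<Union>p\<in>F. S p)"
  have "finite T" using F(1) S by (simp add: T_def)
  then obtain s t where st: "nf s \<noteq> nf t" "\<not> hfm_sat T (W1 s t)" using finite_W1_fails by blast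
  have closed: "closed_under ms_lang UNIV (hfm_fun T)" by (simp add: closed_under_def)
  have "\<forall>p\<in>F. hfm_sat T p" using S unfolding T_def by blast
  then have satA: "\<forall>p\<in>A. hfm_sat T p" using F(3) soundness[OF _ closed] by blast
  have W: "W1 s t \<in> WF_minus" using st(1) unfolding WF_minus_def by blast
  then have sent: "W1 s t \<in> sentences ms_lang" using WF_minus_sentences by blast
  then have "WF_minus \<turnstile>\<^bsub>ms_lang\<^esub> W1 s t" using W by (simp add: sentences_def derives.Ax)
  then have "A \<turnstile>\<^bsub>ms_lang\<^esub> W1 s t" using eq sent by blast
  then have "hfm_sat T (W1 s t)" using soundness[OF _ closed] satA by blast
  then show False using st(2) by blast
qed

section \<open>Interpretations inside a structure\<close>

text \<open>The environment under a block of \<open>length as\<close> quantifiers; in de Bruijn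
  order the head of \<open>as\<close> belongs to the innermost one.\<close>

definition env_append :: "'a list \<Rightarrow> (nat \<Rightarrow> 'a) \<Rightarrow> nat \<Rightarrow> 'a" where
  "env_append as e = (\<lambda>i. if i < length as then as ! i else e (i - length as))"

lemma env_append_Nil [simp]: "env_append [] e = e"
  by (simp add: env_append_def)

text \<open>The outermost quantifier of a block is peeled off first, and its value is the last entry
  of the list; this drives the induction in \<open>sat_exists_dom\<close>.\<close>

lemma env_append_snoc: "env_append (as @ [a]) e = env_append as (case_nat a e)"
proof
  fix i
  show "env_append (as @ [a]) e i = env_append as (case_nat a e) i"
  proof (cases "i \<le> length as")
    case False
    then have "i - length as = Suc (i - Suc (length as))" by simp
    then show ?thesis using False by (simp add: env_append_def)
  qed (auto simp: env_append_def nth_append)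
qed

lemma env_append_Cons: "env_append (a # as) e = case_nat a (env_append as e)"
  by (auto simp: env_append_def fun_eq_iff split: nat.split)

lemma env_append_lt [simp]: "i < length as \<Longrightarrow> env_append as e i = as ! i"
  by (simp add: env_append_def)

lemma env_append_add [simp]: "length as = n \<Longrightarrow> env_append as e (i + n) = e i"
  by (simp add: env_append_def)

text \<open>Assumes only a well-formed translation, because \<open>sat_domain\<close> is already
  used to establish that \<open>dom\<close> is nonempty, which the extended locale requires.\<close>

locale model =
  fixes L :: "('f, 'r) lang" and K :: "('g, 's) lang" and \<tau> :: "('f, 'r, 'g, 's) translation"
    and D :: "'a set" and I :: "'g \<Rightarrow> 'a list \<Rightarrow> 'a" and J :: "'s \<Rightarrow> 'a list \<Rightarrow> bool"
  assumes translation: "is_translation L K \<tau>"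
begin

text \<open>The quantifier over \<open>e\<close>, here and in \<open>graph\<close> and
  \<open>rel_int\<close>, only removes a parameter: by the bounds on free variables in
  \<open>is_translation\<close>, every environment gives the same answer on lists of the right
  length.\<close>

definition dom :: "'a set" where
  "dom = {a \<in> D. \<forall>e. sat D I J (case_nat a e) (domain \<tau>)}"

definition graph :: "'f \<Rightarrow> 'a list \<Rightarrow> 'a \<Rightarrow> bool" where
  "graph f as b \<longleftrightarrow> (\<forall>e. sat D I J (env_append (as @ [b]) e) (fun_graph \<tau> f))"

definition fun_int :: "'f \<Rightarrow> 'a list \<Rightarrow> 'a" where
  "fun_int f as = (SOME b. b \<in> dom \<and> graph f as b)"

definition rel_int :: "'r \<Rightarrow> 'a list \<Rightarrow> bool" where
  "rel_int r as \<longleftrightarrow> (\<forall>e. sat D I J (env_append as e) (rel_def \<tau> r))"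

lemma dom_subset: "dom \<subseteq> D"
  by (auto simp: dom_def)

lemma sat_domain: "sat D I J (case_nat a e) (domain \<tau>) \<longleftrightarrow> a \<in> dom" if "a \<in> D"
proof -
  have "sat D I J (case_nat a e) (domain \<tau>) = sat D I J (case_nat a e') (domain \<tau>)" for e'
    by (rule sat_cong) (use translation in \<open>auto simp: is_translation_def\<close>)
  then show ?thesis using that by (auto simp: dom_def)
qed

text \<open>Stated for any environment with the right first entries, because \<open>at_vars\<close>
  yields environments that are not given in the form \<open>env_append\<close>.\<close>

lemma sat_graph:
  assumes "length as = fun_arity L f" and "\<And>i. i < length as \<Longrightarrow> e i = as ! i" and "e (length as) = b"
  shows "sat D I J e (fun_graph \<tau> f) \<longleftrightarrow> graph f as b"
proof -
  have "sat D I J e (fun_graph \<tau> f) = sat D I J (env_append (as @ [b]) e') (fun_graph \<tau> f)" for e'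
  proof (rule sat_cong)
    fix x assume "x \<in> fv (fun_graph \<tau> f)"
    then have "x \<le> fun_arity L f" using translation by (auto simp: is_translation_def)
    then show "e x = env_append (as @ [b]) e' x"
      using assms by (cases "x = length as") (auto simp: nth_append)
  qed
  then show ?thesis by (auto simp: graph_def)
qed

lemma sat_rel_def:
  assumes "length as = rel_arity L r"
  shows "sat D I J (env_append as e) (rel_def \<tau> r) \<longleftrightarrow> rel_int r as"
proof -
  have "sat D I J (env_append as e) (rel_def \<tau> r) = sat D I J (env_append as e') (rel_def \<tau> r)" for e'
  proof (rule sat_cong)
    fix x assume "x \<in> fv (rel_def \<tau> r)"
    then have "x < rel_arity L r" using translation by (auto simp: is_translation_def)
    then show "env_append as e x = env_append as e' x" using assms by simp
  qed
  then show ?thesis by (auto simp: rel_int_def)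
qed

lemma sat_exists_dom:
  "sat D I J e (exists_dom \<tau> n p) \<longleftrightarrow>
    (\<exists>as. length as = n \<and> set as \<subseteq> dom \<and> sat D I J (env_append as e) p)"
proof (induction n arbitrary: e)
  case 0
  then show ?case by (simp add: exists_dom_def)
next
  case (Suc n)
  have "sat D I J e (exists_dom \<tau> (Suc n) p) \<longleftrightarrow>
    (\<exists>a\<in>D. sat D I J (case_nat a e) (domain \<tau>) \<and> sat D I J (case_nat a e) (exists_dom \<tau> n p))"
    by (simp add: exists_dom_def)
  also have "\<dots> \<longleftrightarrow> (\<exists>a\<in>dom. sat D I J (case_nat a e) (exists_dom \<tau> n p))"
    using sat_domain dom_subset by blast
  also have "\<dots> \<longleftrightarrow> (\<exists>a\<in>dom. \<exists>as. length as = n \<and> set as \<subseteq> dom \<and>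
      sat D I J (env_append (as @ [a]) e) p)"
    by (simp add: Suc env_append_snoc)
  also have "\<dots> \<longleftrightarrow> (\<exists>as. length as = Suc n \<and> set as \<subseteq> dom \<and> sat D I J (env_append as e) p)"
  proof safe
    fix as assume "length as = Suc n" "set as \<subseteq> dom" "sat D I J (env_append as e) p"
    then show "\<exists>a\<in>dom. \<exists>as. length as = n \<and> set as \<subseteq> dom \<and> sat D I J (env_append (as @ [a]) e) p"
      by (cases as rule: rev_cases) auto
  next
    fix a as assume "a \<in> dom" "set as \<subseteq> dom" "sat D I J (env_append (as @ [a]) e) p" "n = length as"
    then show "\<exists>bs. length bs = Suc (length as) \<and> set bs \<subseteq> dom \<and> sat D I J (env_append bs e) p"
      by (intro exI[of _ "as @ [a]"]) auto
  qed
  finally show ?case .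
qed

lemma sat_foralls_dom:
  "sat D I J e (foralls_dom \<tau> n p) \<longleftrightarrow>
    (\<forall>as. length as = n \<longrightarrow> set as \<subseteq> dom \<longrightarrow> sat D I J (env_append as e) p)"
proof -
  have "sat D I J e (foralls_dom \<tau> n p) \<longleftrightarrow> \<not> sat D I J e (exists_dom \<tau> n (Neg p))"
    by (induction n arbitrary: e) (simp_all add: foralls_dom_def exists_dom_def)
  then show ?thesis by (auto simp: sat_exists_dom)
qed

lemma sat_at_vars:
  "sat D I J e (at_vars xs p) = sat D I J (\<lambda>i. e (if i < length xs then xs ! i else i)) p"
  by (simp add: at_vars_def sat_subst)

lemma sat_graph_at_vars:
  assumes "length as = fun_arity L f" and "length xs = length as" and "\<And>i. i < length as \<Longrightarrow> e (xs ! i) = as ! i"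
  shows "sat D I J e (at_vars (xs @ [y]) (fun_graph \<tau> f)) \<longleftrightarrow> graph f as (e y)"
  unfolding sat_at_vars by (rule sat_graph) (use assms in \<open>auto simp: nth_append\<close>)

end

text \<open>One environment suffices in each assumption, because \<open>graph_total\<close> and
  \<open>graph_functional\<close> are closed formulas here.\<close>

locale interpretation_model = model +
  assumes dom_nonempty: "dom \<noteq> {}"
    and total: "\<And>f. \<exists>e. sat D I J e (graph_total \<tau> (fun_arity L f) f)"
    and functional: "\<And>f. \<exists>e. sat D I J e (graph_functional \<tau> (fun_arity L f) f)"
begin

section \<open>Functions defined by the translated graphs\<close>

lemma graph_ex:
  assumes "length as = fun_arity L f" and "set as \<subseteq> dom"
  shows "\<exists>b\<in>dom. graph f as b"
proof -
  obtain e where "sat D I J e (graph_total \<tau> (fun_arity L f) f)" using total by blast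
  then have "sat D I J (env_append as e)
      (exists_dom \<tau> 1 (at_vars ([1..<Suc (length as)] @ [0]) (fun_graph \<tau> f)))"
    using assms unfolding graph_total_def sat_foralls_dom by simp
  then obtain bs where bs: "length bs = 1" "set bs \<subseteq> dom"
    "sat D I J (env_append bs (env_append as e)) (at_vars ([1..<Suc (length as)] @ [0]) (fun_graph \<tau> f))"
    unfolding sat_exists_dom by blast
  then obtain b where b: "bs = [b]" by (auto simp: length_Suc_conv)
  \<comment> \<open>The quantifier for the value is innermost, so index 0 is the value and index i +
    1 the argument \<open>as ! i\<close>.\<close>
  have "graph f as (env_append bs (env_append as e) 0)"
    using bs(3) by (subst (asm) sat_graph_at_vars[OF assms(1)]) (simp_all add: b env_append_Cons del: upt_Suc)
  then show ?thesis using bs b by auto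
qed

lemma graph_unique:
  assumes "length as = fun_arity L f" and "set as \<subseteq> dom" and "b \<in> dom" "c \<in> dom"
    and "graph f as b" "graph f as c"
  shows "b = c"
proof -
  obtain e where e: "sat D I J e (graph_functional \<tau> (fun_arity L f) f)" using functional by blast
  let ?n = "length as"
  \<comment> \<open>The two innermost quantifiers bind the candidate values; the arguments start at
    index 2.\<close>
  let ?e = "env_append (b # c # as) e"
  have "sat D I J ?e
       (at_vars ([2..<?n + 2] @ [0]) (fun_graph \<tau> f) \<^bold>\<and>
        at_vars ([2..<?n + 2] @ [1]) (fun_graph \<tau> f) \<^bold>\<longrightarrow> Var 0 \<^bold>= Var 1)"
    using e assms unfolding graph_functional_def sat_foralls_dom
    by (auto dest!: spec[of _ "b # c # as"])
  moreover have "sat D I J ?e (at_vars ([2..<?n + 2] @ [y]) (fun_graph \<tau> f)) \<longleftrightarrow> graph f as (?e y)" for y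
    by (rule sat_graph_at_vars[OF assms(1)]) (simp_all del: upt_Suc)
  ultimately show ?thesis using assms(5,6) by (simp add: env_append_Cons del: upt_Suc)
qed

lemma fun_int_props:
  assumes "length as = fun_arity L f" and "set as \<subseteq> dom"
  shows "fun_int f as \<in> dom" "graph f as (fun_int f as)"
proof -
  have "\<exists>b. b \<in> dom \<and> graph f as b" using graph_ex[OF assms] by blast
  then have "fun_int f as \<in> dom \<and> graph f as (fun_int f as)"
    unfolding fun_int_def by (rule someI_ex)
  then show "fun_int f as \<in> dom" "graph f as (fun_int f as)" by auto
qed

lemma graph_iff:
  assumes "length as = fun_arity L f" and "set as \<subseteq> dom" and "b \<in> dom"
  shows "graph f as b \<longleftrightarrow> fun_int f as = b"
  using fun_int_props[OF assms(1,2)] graph_unique[OF assms(1,2) assms(3)] by blast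

lemma closed: "closed_under L dom fun_int"
  by (simp add: closed_under_def fun_int_props)

text \<open>Unnesting is correct. Induction for all \<open>e\<close>, \<open>k\<close> and
  \<open>y\<close>, because arguments are read below a further block of quantifiers, with a larger
  offset.\<close>

lemma sat_value_fm:
  assumes "is_tm L t" and "\<forall>x. e x \<in> dom"
  shows "sat D I J e (value_fm \<tau> k t y) \<longleftrightarrow> eval_tm fun_int (\<lambda>x. e (x + k)) t = e y"
  using assms
proof (induction t arbitrary: e k y)
  case (Fn f ts)
  let ?n = "length ts" and ?v = "eval_tm fun_int (\<lambda>x. e (x + k))"
  have vs: "set (map ?v ts) \<subseteq> dom"
    using eval_tm_in[OF closed, of "\<lambda>x. e (x + k)"] Fn.prems by auto
  \<comment> \<open>The block of existential quantifiers has exactly one possible list of witnesses,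
    the values of the arguments.\<close>
  have args: "(\<forall>p\<in>set (map (\<lambda>i. value_fm \<tau> (k + ?n) (ts ! i) i) [0..<?n]). sat D I J (env_append as e) p)
      \<longleftrightarrow> as = map ?v ts" if as: "length as = ?n" "set as \<subseteq> dom" for as
  proof -
    have e: "\<forall>x. env_append as e x \<in> dom"
      using as Fn.prems(2) by (auto simp: env_append_def)
    have "sat D I J (env_append as e) (value_fm \<tau> (k + ?n) (ts ! i) i) \<longleftrightarrow> ?v (ts ! i) = as ! i"
      if "i < ?n" for i
    proof -
      \<comment> \<open>The witnesses push the old variables up by \<open>?n\<close>, which the
        offset \<open>k + ?n\<close> undoes.\<close>
      have "(\<lambda>x. env_append as e (x + (k + ?n))) = (\<lambda>x. e (x + k))"
        using as(1) by (simp add: env_append_def)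
      then show ?thesis using Fn.IH[of "ts ! i" "env_append as e" "k + ?n" i] Fn.prems(1) e that as(1)
        by simp
    qed
    then have "(\<forall>i<?n. sat D I J (env_append as e) (value_fm \<tau> (k + ?n) (ts ! i) i)) \<longleftrightarrow>
        (\<forall>i<?n. as ! i = ?v (ts ! i))" by metis
    also have "\<dots> \<longleftrightarrow> as = map ?v ts" using as(1) by (simp add: list_eq_iff_nth_eq)
    finally show ?thesis by (simp only: ball_map_upt)
  qed
  have graph: "sat D I J (env_append (map ?v ts) e) (at_vars ([0..<?n] @ [y + ?n]) (fun_graph \<tau> f))
      \<longleftrightarrow> fun_int f (map ?v ts) = e y"
  proof -
    have "sat D I J (env_append (map ?v ts) e) (at_vars ([0..<?n] @ [y + ?n]) (fun_graph \<tau> f))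
      \<longleftrightarrow> graph f (map ?v ts) (env_append (map ?v ts) e (y + ?n))"
      by (rule sat_graph_at_vars) (use Fn.prems(1) in simp_all)
    also have "\<dots> \<longleftrightarrow> fun_int f (map ?v ts) = e y"
      using graph_iff[OF _ vs] Fn.prems by simp
    finally show ?thesis .
  qed
  have "sat D I J e (value_fm \<tau> k (Fn f ts) y) \<longleftrightarrow>
      (\<exists>as. length as = ?n \<and> set as \<subseteq> dom \<and> as = map ?v ts \<and>
        sat D I J (env_append as e) (at_vars ([0..<?n] @ [y + ?n]) (fun_graph \<tau> f)))"
    unfolding value_fm.simps Let_def sat_exists_dom sat_foldr_Conj using args by blast
  also have "\<dots> \<longleftrightarrow> fun_int f (map ?v ts) = e y"
    using vs graph by auto
  finally show ?case by simp
qed simp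

text \<open>Turns true translations of axioms into a model of the axioms, with universe
  \<open>dom\<close>.\<close>

lemma sat_translate:
  assumes "is_fm L p" and "\<forall>x. e x \<in> dom"
  shows "sat D I J e (translate \<tau> p) \<longleftrightarrow> sat dom fun_int rel_int e p"
  using assms
proof (induction p arbitrary: e)
  case (Eq s t)
  have "sat D I J (env_append as e) (value_fm \<tau> 2 u i) \<longleftrightarrow> eval_tm fun_int e u = as ! i"
    if "length as = 2" "set as \<subseteq> dom" "i < 2" "is_tm L u" for as u i
  proof -
    have "\<forall>x. env_append as e x \<in> dom" using that Eq.prems(2) by (auto simp: env_append_def)
    moreover have "(\<lambda>x. env_append as e (x + 2)) = e" using that(1) by (simp only: env_append_add)
    ultimately show ?thesis
      using sat_value_fm[of u "env_append as e" 2 i] that by (simp only: env_append_lt simp_thms)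
  qed
  then have "sat D I J e (translate \<tau> (s \<^bold>= t)) \<longleftrightarrow>
    (\<exists>as. length as = 2 \<and> set as \<subseteq> dom \<and> eval_tm fun_int e s = as ! 0 \<and> eval_tm fun_int e t = as ! 1 \<and>
      as ! 0 = as ! 1)"
    using Eq.prems(1) by (auto simp: sat_exists_dom)
  moreover have "eval_tm fun_int e s \<in> dom"
    using eval_tm_in[OF closed] Eq.prems by simp
  \<comment> \<open>The common value serves for both quantified variables.\<close>
  ultimately show ?case
    by (auto intro: exI[of _ "[eval_tm fun_int e s, eval_tm fun_int e s]"])
next
  case (Rel r ts)
  let ?n = "length ts" and ?v = "eval_tm fun_int e"
  have vs: "set (map ?v ts) \<subseteq> dom"
    using eval_tm_in[OF closed] Rel.prems by auto
  have args: "(\<forall>p\<in>set (map (\<lambda>i. value_fm \<tau> ?n (ts ! i) i) [0..<?n]). sat D I J (env_append as e) p)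
      \<longleftrightarrow> as = map ?v ts" if as: "length as = ?n" "set as \<subseteq> dom" for as
  proof -
    have e: "\<forall>x. env_append as e x \<in> dom"
      using as Rel.prems(2) by (auto simp: env_append_def)
    have "sat D I J (env_append as e) (value_fm \<tau> ?n (ts ! i) i) \<longleftrightarrow> ?v (ts ! i) = as ! i"
      if "i < ?n" for i
      using sat_value_fm[of "ts ! i" "env_append as e" ?n i] Rel.prems(1) e that as(1) by simp
    then have "(\<forall>i<?n. sat D I J (env_append as e) (value_fm \<tau> ?n (ts ! i) i)) \<longleftrightarrow>
        (\<forall>i<?n. as ! i = ?v (ts ! i))" by metis
    also have "\<dots> \<longleftrightarrow> as = map ?v ts" using as(1) by (simp add: list_eq_iff_nth_eq)
    finally show ?thesis by (simp only: ball_map_upt)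
  qed
  have "sat D I J e (translate \<tau> (Rel r ts)) \<longleftrightarrow>
      (\<exists>as. length as = ?n \<and> set as \<subseteq> dom \<and> as = map ?v ts \<and> sat D I J (env_append as e) (rel_def \<tau> r))"
    unfolding translate.simps Let_def sat_exists_dom sat_foldr_Conj using args by blast
  also have "\<dots> \<longleftrightarrow> rel_int r (map ?v ts)"
    using vs sat_rel_def[of "map ?v ts" r e] Rel.prems(1) by auto
  finally show ?case by simp
next
  case (Forall p)
  have "sat D I J e (translate \<tau> (Forall p)) \<longleftrightarrow> (\<forall>a\<in>dom. sat D I J (case_nat a e) (translate \<tau> p))"
    using sat_domain dom_subset by (simp add: subset_iff) blast
  moreover have "sat D I J (case_nat a e) (translate \<tau> p) \<longleftrightarrow> sat dom fun_int rel_int (case_nat a e) p"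
    if "a \<in> dom" for a
    using that Forall.prems by (intro Forall.IH) (auto split: nat.split)
  ultimately show ?case by simp
qed simp_all

end

section \<open>Finite structures and F-minus\<close>

lemma F_minus_no_finite_model:
  assumes closed: "closed_under ms_lang D I" and e: "\<forall>x. e x \<in> D" and "finite D"
    and sat: "\<forall>p\<in>F_minus. sat D I J e p"
  shows False
proof -
  let ?u = "\<lambda>x y. I Union_sym [x, y]" and ?o = "I Empty_sym []"
  define s where "s = I Single_sym [?o]"
  have o: "?o \<in> D" and s: "s \<in> D" and u: "\<And>x y. x \<in> D \<Longrightarrow> y \<in> D \<Longrightarrow> ?u x y \<in> D"
    using closed by (auto simp: closed_under_def ms_lang_def s_def split: ms_fun.splits)
  have comm: "\<forall>x\<in>D. \<forall>y\<in>D. ?u x y = ?u y x"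
    using sat by (simp add: F_minus_def F2_def foralls_def Let_def numeral_eq_Suc)
  have cancel: "\<forall>x\<in>D. \<forall>y\<in>D. \<forall>z\<in>D. ?u x z = ?u y z \<longrightarrow> x = y"
    using sat by (simp add: F_minus_def F4_def foralls_def Let_def numeral_eq_Suc)
  have "s \<noteq> ?o"
    using sat o by (simp add: F_minus_def F5_def foralls_def Let_def s_def)
  have zero: "\<forall>x\<in>D. \<forall>y\<in>D. ?u x y = ?o \<longrightarrow> x = ?o"
    using sat by (simp add: F_minus_def F6_def foralls_def Let_def numeral_eq_Suc)
  have "(\<lambda>y. ?u y s) ` D = D"
    using \<open>finite D\<close> u s cancel by (intro endo_inj_surj inj_onI) blast+
  with o have "?o \<in> (\<lambda>y. ?u y s) ` D" by (simp only:)
  then obtain y where y: "y \<in> D" "?o = ?u y s" by (rule imageE)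
  \<comment> \<open>Commutativity brings \<open>s\<close> to the left, where \<open>F6\<close>
    speaks about it.\<close>
  have "?u s y = ?o" using comm s y by simp
  then show False using zero s y(1) \<open>s \<noteq> ?o\<close> by blast
qed

section \<open>Finite models of finite parts of R\<close>

text \<open>All numbers from \<open>N\<close> on are merged into a top element that is its own
  successor. The last equation also interprets \<open>Zero_sym\<close>.\<close>

fun cut_fun :: "nat \<Rightarrow> arith_fun \<Rightarrow> nat list \<Rightarrow> nat" where
  "cut_fun N Succ_sym [x] = min N (Suc x)"
| "cut_fun N Plus_sym [x, y] = min N (x + y)"
| "cut_fun N Times_sym [x, y] = min N (x * y)"
| "cut_fun N _ _ = 0"

fun le_rel :: "arith_rel \<Rightarrow> nat list \<Rightarrow> bool" where
  "le_rel Le_sym [x, y] = (x \<le> y)"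
| "le_rel Le_sym _ = False"

abbreviation cut_sat :: "nat \<Rightarrow> (nat \<Rightarrow> nat) \<Rightarrow> (arith_fun, arith_rel) fm \<Rightarrow> bool" where
  "cut_sat N \<equiv> sat {..N} (cut_fun N) le_rel"

lemma cut_fun_le: "cut_fun N f as \<le> N"
  by (induction N f as rule: cut_fun.induct) auto

lemma eval_num: "eval_tm (cut_fun N) e (num n) = min N n"
  by (induction n) auto

text \<open>If one factor exceeds \<open>N\<close> and neither is 0, both products are at least
  \<open>N\<close>; otherwise a factor is 0 or no factor is cut.\<close>

lemma min_mult_min: "min N (min N n * min N m) = min N (n * m :: nat)"
proof (cases "n \<le> N \<and> m \<le> N \<or> n = 0 \<or> m = 0")
  case False
  then have "N \<le> min N n * min N m"
    by (cases "n \<le> N"; cases "m \<le> N") (auto simp: min_def not_le)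
  moreover have "min N n * min N m \<le> n * m" by (intro mult_le_mono) auto
  ultimately show ?thesis by simp
qed (auto simp: min_def)

text \<open>Only the inequations force \<open>N\<close> up, to keep their two numerals apart. The
  other axioms hold at every \<open>N\<close>, since cutting respects sums and products and
  \<open>le_rel\<close> is the usual linear order.\<close>

lemma R_theory_finite_support:
  assumes "p \<in> R_theory"
  shows "\<exists>N. \<forall>N'\<ge>N. \<forall>e. cut_sat N' e p"
proof -
  consider n m where "p = (Fn Plus_sym [num n, num m] \<^bold>= num (n + m))"
    | n m where "p = (Fn Times_sym [num n, num m] \<^bold>= num (n * m))"
    | n m where "p = Neg (num n \<^bold>= num m)" "n \<noteq> m"
    | n where "p = Forall (Rel Le_sym [Var 0, num n] \<^bold>\<longleftrightarrow> disj_list (map (\<lambda>i. Var 0 \<^bold>= num i) [0..<Suc n]))"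
    | n where "p = Forall (Rel Le_sym [Var 0, num n] \<^bold>\<or> Rel Le_sym [num n, Var 0])"
    using assms unfolding R_theory_def by blast
  then show ?thesis
  proof cases
    case 1
    then show ?thesis by (auto simp: eval_num)
  next
    case 2
    then show ?thesis by (simp add: eval_num min_mult_min)
  next
    case 3
    then show ?thesis by (intro exI[of _ "max n m"]) (auto simp: eval_num)
  next
    case (4 n)
    \<comment> \<open>The witness is \<open>x\<close> itself, which equals \<open>min N x\<close>;
      when \<open>n\<close> exceeds \<open>N\<close>, both sides hold for every
      \<open>x\<close>.\<close>
    have "x \<le> min N n \<longleftrightarrow> (\<exists>i\<in>{0..<Suc n}. x = min N i)" if "x \<le> N" for x N
      using that by (auto intro!: bexI[of _ x])
    then show ?thesis unfolding 4 by (simp add: sat_disj_list eval_num del: upt_Suc)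
  next
    case 5
    then show ?thesis by (auto simp: eval_num)
  qed
qed

lemma finite_R_theory_model:
  assumes "finite T" and "T \<subseteq> R_theory"
  obtains N where "\<forall>p\<in>T. \<forall>e. cut_sat N e p"
proof -
  have "\<forall>p\<in>T. \<exists>N. \<forall>N'\<ge>N. \<forall>e. cut_sat N' e p"
    using assms(2) R_theory_finite_support by blast
  then obtain B where B: "\<forall>p\<in>T. \<forall>N'\<ge>B p. \<forall>e. cut_sat N' e p" by metis
  \<comment> \<open>\<open>insert 0\<close> keeps \<open>Max\<close> meaningful when
    \<open>T\<close> is empty.\<close>
  have "\<forall>p\<in>T. B p \<le> Max (insert 0 (B ` T))" using assms(1) by simp
  then show ?thesis using B by (intro that) blast
qed

section \<open>No interpretation of F-minus in R\<close>

lemma not_interpretable_F_minus_R: "\<not> interpretable ms_lang F_minus arith_lang R_theory"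
proof
  assume "interpretable ms_lang F_minus arith_lang R_theory"
  then obtain \<tau> where \<tau>: "is_translation ms_lang arith_lang \<tau>"
    and dom: "R_theory \<turnstile>\<^bsub>arith_lang\<^esub> Exists (domain \<tau>)"
    and graphs: "\<And>f. R_theory \<turnstile>\<^bsub>arith_lang\<^esub> graph_total \<tau> (fun_arity ms_lang f) f"
      "\<And>f. R_theory \<turnstile>\<^bsub>arith_lang\<^esub> graph_functional \<tau> (fun_arity ms_lang f) f"
    and axs: "\<forall>p\<in>F_minus. R_theory \<turnstile>\<^bsub>arith_lang\<^esub> translate \<tau> p"
    unfolding interpretable_def by blast
  \<comment> \<open>Everything the interpretation requires of \<open>R_theory\<close>, as one finite
    set: there are finitely many function symbols and finitely many axioms.\<close>
  define A where "A = {Exists (domain \<tau>)} \<union> range (\<lambda>f. graph_total \<tau> (fun_arity ms_lang f) f) \<union>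
    range (\<lambda>f. graph_functional \<tau> (fun_arity ms_lang f) f) \<union> translate \<tau> ` F_minus"
  have "UNIV = {Empty_sym, Single_sym, Union_sym}" using ms_fun.exhaust by blast
  then have "finite (UNIV :: ms_fun set)" by (metis finite.simps)
  then have fin: "finite A" by (simp add: A_def F_minus_def)
  have "\<forall>p\<in>A. R_theory \<turnstile>\<^bsub>arith_lang\<^esub> p"
    using dom graphs axs by (auto simp: A_def)
  from derives_compact_finite[OF fin this] obtain T
    where T: "finite T" "T \<subseteq> R_theory" "\<forall>p\<in>A. T \<turnstile>\<^bsub>arith_lang\<^esub> p" .
  obtain N where N: "\<forall>p\<in>T. \<forall>e. cut_sat N e p" using finite_R_theory_model[OF T(1,2)] .
  have "closed_under arith_lang {..N} (cut_fun N)" by (simp add: closed_under_def cut_fun_le)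
  note sound = soundness[OF _ this]
  have A: "cut_sat N e p" if "p \<in> A" "\<forall>x. e x \<in> {..N}" for e p
    using T(3) N that by (intro sound) auto
  interpret model ms_lang arith_lang \<tau> "{..N}" "cut_fun N" le_rel
    by unfold_locales (rule \<tau>)
  have "cut_sat N (\<lambda>_. 0) (Exists (domain \<tau>))" by (rule A) (simp_all add: A_def)
  then obtain d where d: "d \<in> dom" using sat_domain by auto
  interpret interpretation_model ms_lang arith_lang \<tau> "{..N}" "cut_fun N" le_rel
  proof
    show "dom \<noteq> {}" using d by blast
    fix f
    show "\<exists>e. cut_sat N e (graph_total \<tau> (fun_arity ms_lang f) f)"
      by (intro exI[of _ "\<lambda>_. 0"] A) (simp_all add: A_def)
    show "\<exists>e. cut_sat N e (graph_functional \<tau> (fun_arity ms_lang f) f)"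
      by (intro exI[of _ "\<lambda>_. 0"] A) (simp_all add: A_def)
  qed
  have "sat dom fun_int rel_int (\<lambda>_. d) p" if "p \<in> F_minus" for p
  proof -
    have "cut_sat N (\<lambda>_. d) (translate \<tau> p)"
      using that d dom_subset by (intro A) (auto simp: A_def)
    moreover have "is_fm ms_lang p" using that F_minus_sentences by (auto simp: sentences_def)
    ultimately show ?thesis using sat_translate d by simp
  qed
  \<comment> \<open>Being a subset of \<open>{..N}\<close>, \<open>dom\<close> is finite.\<close>
  then show False
    using F_minus_no_finite_model[OF closed, of "\<lambda>_. d"] d finite_subset[OF dom_subset] by blast
qed

theorem corollary5p10:
  shows "\<not> finitely_axiomatizable ms_lang WF_minus
    \<and> \<not> interpretable ms_lang F_minus arith_lang R_theory"
  using not_finitely_axiomatizable_WF_minus not_interpretable_F_minus_R by blast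

end
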